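(* Let $G(s)$ be a scalar transfer function that is real and strictly proper. (a) The Rayleigh-screened and exact OF-PD bands coincide, $\tilde\Omega_{\rm PD}(\sigma)=\Omega_{\rm PD}(\sigma)$, whenever both are defined; that is, for every $\sigma\ge0$ and every $\omega\ge0$ such that $j\omega$ is not a pole of $G$ and $1-\sigma G(j\omega)\ne0$, one has $\omega\in\tilde\Omega_{\rm PD}(\sigma)$ if and only if $\omega\in\Omega_{\rm PD}(\sigma)$. (b) For any real $\sigma_2>\sigma_1$, the inclusion $\Omega_{\rm PD}(\sigma_2)\subseteq\Omega_{\rm PD}(\sigma_1)$ holds on the common regularity domain; that is, for every $\omega\ge 0$ such that $j\omega$ is not a pole of $G$ and $1-\sigma_iG(j\omega)\neq0$ for $i=1,2$, $\omega\in\Omega_{\rm PD}(\sigma_2)$ implies $\omega\in\Omega_{\rm PD}(\sigma_1)$.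
   Context: A transfer function is a rational function of $s$; "real" means real coefficients. For $\sigma\in\mathbb R$ let $H_\sigma(s)=G(s)/(1-\sigma G(s))$ wherever well-defined. The output-feedback positive-damping (OF-PD) frequency band is $$\Omega_{\rm PD}(\sigma)=\{\omega\ge0:\ j\omega\text{ is not a pole of }G,\ 1-\sigma G(j\omega)\neq 0,\ 2\Re(H_\sigma(j\omega))\ge0\}.$$ For $\sigma\ge0$ the Rayleigh-screened band is the set of $\omega\ge0$ with $j\omega$ not a pole of $G$ such that $\Re(\rho_{G(j\omega)}(x))\ge\sigma|\rho_{G(j\omega)}(x)|^2$ for all $x\ne0$, where $\rho_M(x)=x^HMx/(x^Hx)$; for scalar $G$ this is $$\tilde\Omega_{\rm PD}(\sigma)=\{\omega\ge0:\ j\omega\text{ is not a pole of }G,\ \Re(G(j\omega))\ge\sigma|G(j\omega)|^2\}.$$ *)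

theory Defs
  imports
    "HOL-Complex_Analysis.Complex_Analysis"
    "HOL-Computational_Algebra.Computational_Algebra"
    "HOL-Computational_Algebra.Field_as_Ring"
begin

type_synonym transfer_function = "complex poly fract"

text \<open>
  \<^const>\<open>quot_of_fract\<close> gives the fraction in lowest terms, so \<open>tf_eval G\<close> is the value of
  the rational function at every point where it is regular, removable singularities included.
  At a pole, \<open>tf_eval\<close> has the junk value \<open>0\<close>; the bands below exclude those points.
\<close>

definition tf_eval :: "transfer_function \<Rightarrow> complex \<Rightarrow> complex" where
  "tf_eval G s = poly (fst (quot_of_fract G)) s / poly (snd (quot_of_fract G)) s"

lemma is_pole_tf_eval_iff:
  "is_pole (tf_eval G) s \<longleftrightarrow> poly (snd (quot_of_fract G)) s = 0"
proof -
  define n d where "n = fst (quot_of_fract G)" and "d = snd (quot_of_fract G)"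
  have eval: "tf_eval G = (\<lambda>z. poly n z / poly d z)"
    by (simp add: tf_eval_def n_def d_def fun_eq_iff)
  have nd: "coprime n d" "d \<noteq> 0"
    using quot_of_fract_in_normalized_fracts[of G]
    by (auto simp: n_def d_def normalized_fracts_def case_prod_unfold)
  have "is_pole (tf_eval G) s" if d0: "poly d s = 0"
  proof -
    have "poly n s \<noteq> 0"
      using nd d0 coprime_poly_0 by blast
    moreover have "\<forall>\<^sub>F z in at s. poly d z \<noteq> 0"
      using islimpt_finite[OF poly_roots_finite[OF nd(2)], of s]
      by (simp add: islimpt_iff_eventually)
    moreover have "(poly d \<longlongrightarrow> 0) (at s)"
      using poly_isCont[of s d] d0 by (simp add: isCont_def)
    ultimately show ?thesis
      unfolding eval 
      by (intro is_pole_divide) (auto simp: filterlim_at)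
  qed
  moreover have "\<not> is_pole (tf_eval G) s" if "poly d s \<noteq> 0"
  proof (rule not_is_pole_holomorphic)
    show "open {z. poly d z \<noteq> 0}"
      by (intro open_Collect_neq continuous_intros)
    show "tf_eval G holomorphic_on {z. poly d z \<noteq> 0}"
      unfolding eval by (intro holomorphic_intros) auto
  qed (use that in auto)
  ultimately show ?thesis
    unfolding d_def by blast
qed

definition tf_real :: "transfer_function \<Rightarrow> bool" where
  "tf_real G \<longleftrightarrow> (\<exists>p q :: real poly. q \<noteq> 0 \<and>
     G = Fract (map_poly complex_of_real p) (map_poly complex_of_real q))"

text \<open>
  The disjunct for the zero function is needed because \<^term>\<open>degree 0 = 0\<close>, and zero is \<open>0 / 1\<close>
  in lowest terms.
\<close>

definition tf_strictly_proper :: "transfer_function \<Rightarrow> bool" where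
  "tf_strictly_proper G \<longleftrightarrow>
     G = 0 \<or> degree (fst (quot_of_fract G)) < degree (snd (quot_of_fract G))"

definition tf_H :: "transfer_function \<Rightarrow> real \<Rightarrow> complex \<Rightarrow> complex" where
  "tf_H G \<sigma> s = tf_eval G s / (1 - of_real \<sigma> * tf_eval G s)"

definition of_pd_band :: "transfer_function \<Rightarrow> real \<Rightarrow> real set" where
  "of_pd_band G \<sigma> = {\<omega>. \<omega> \<ge> 0 \<and> \<not> is_pole (tf_eval G) (\<i> * of_real \<omega>) \<and>
     1 - of_real \<sigma> * tf_eval G (\<i> * of_real \<omega>) \<noteq> 0 \<and>
     2 * Re (tf_H G \<sigma> (\<i> * of_real \<omega>)) \<ge> 0}"

definition rayleigh_quotient :: "complex ^ 'n ^ 'n \<Rightarrow> complex ^ 'n \<Rightarrow> complex" where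
  "rayleigh_quotient M x =
     (\<Sum>i\<in>UNIV. cnj (x $ i) * (M *v x) $ i) / (\<Sum>i\<in>UNIV. cnj (x $ i) * x $ i)"

text \<open>
  The Rayleigh-screened band is defined for square transfer matrices, a pole of the matrix being
  a pole of one of its entries. A scalar \<open>G\<close> enters as the \<open>1 \<times> 1\<close> matrix \<^term>\<open>mat G\<close>.
\<close>

definition rayleigh_screened_band :: "transfer_function ^ 'n ^ 'n \<Rightarrow> real \<Rightarrow> real set" where
  "rayleigh_screened_band G \<sigma> = {\<omega>. \<omega> \<ge> 0 \<and>
     (\<forall>i j. \<not> is_pole (tf_eval (G $ i $ j)) (\<i> * of_real \<omega>)) \<and>
     (\<forall>x. x \<noteq> 0 \<longrightarrow>
        (let \<rho> = rayleigh_quotient (\<chi> i j. tf_eval (G $ i $ j) (\<i> * of_real \<omega>)) x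
         in Re \<rho> \<ge> \<sigma> * (cmod \<rho>)\<^sup>2))}"

abbreviation scalar_rayleigh_screened_band :: "transfer_function \<Rightarrow> real \<Rightarrow> real set" where
  "scalar_rayleigh_screened_band G \<equiv> rayleigh_screened_band (mat G :: transfer_function ^ 1 ^ 1)"

lemma scalar_rayleigh_screened_band_eq:
  "scalar_rayleigh_screened_band G \<sigma> = {\<omega>. \<omega> \<ge> 0 \<and> \<not> is_pole (tf_eval G) (\<i> * of_real \<omega>) \<and>
     Re (tf_eval G (\<i> * of_real \<omega>)) \<ge> \<sigma> * (cmod (tf_eval G (\<i> * of_real \<omega>)))\<^sup>2}"
proof -
  have rq: "rayleigh_quotient (\<chi> i j. c) x = c" if "x \<noteq> 0" for c and x :: "complex ^ 1"
  proof -
    have "x $ 1 \<noteq> 0"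
      using that by (simp add: vec_eq_iff)
    then show ?thesis
      by (simp add: rayleigh_quotient_def matrix_vector_mult_def)
  qed
  have entry: "(mat G :: transfer_function ^ 1 ^ 1) $ i $ j = G" for i j
  proof -
    have "i = j" by (metis num1_eq1)
    then show ?thesis by (simp add: mat_def)
  qed
  have ex: "\<exists>x :: complex ^ 1. x \<noteq> 0"
    by (rule exI[of _ "vec 1"]) (simp add: vec_eq_iff)
  show ?thesis
    unfolding rayleigh_screened_band_def Let_def entry
    using rq ex by auto
qed

end

theory Submission
  imports Defs
begin

text \<open>Write \<open>g\<close> for the value of \<open>G\<close> at a regular point of the
  imaginary axis. Multiplying numerator and denominator of \<open>g / (1 - \<sigma> g)\<close> by
  the conjugate denominator leaves the real part \<open>Re g - \<sigma> |g|^2\<close> over a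
  positive number. So where both bands are defined, the exact condition is the Rayleigh inequality,
  which is (a). Its right-hand side \<open>\<sigma> |g|^2\<close> is nondecreasing in \<sigma>,
  which gives (b).\<close>

lemma Re_feedback_nonneg_iff:
  fixes g :: complex
  assumes "1 - of_real \<sigma> * g \<noteq> 0"
  shows "Re (g / (1 - of_real \<sigma> * g)) \<ge> 0 \<longleftrightarrow> Re g \<ge> \<sigma> * (cmod g)\<^sup>2"
proof -
  have "Re (g / (1 - of_real \<sigma> * g)) = (Re g - \<sigma> * (cmod g)\<^sup>2) / (cmod (1 - of_real \<sigma> * g))\<^sup>2"
    \<comment> \<open>As \<sigma> is real,
      \<open>g * cnj (1 - \<sigma> g) = g - \<sigma> |g|^2\<close>, and the subtracted term is
      real.\<close>
    unfolding Re_divide' cmod_power2[of g] by (simp add: power2_eq_square algebra_simps)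
  moreover have "(cmod (1 - of_real \<sigma> * g))\<^sup>2 > 0"
    using assms by simp
  ultimately show ?thesis
    by (simp add: zero_le_divide_iff)
qed

text \<open>This removes the feedback denominator from the band condition. It holds for \<sigma> of
  either sign, so (b) can apply it at negative values too.\<close>

lemma mem_of_pd_band_iff:
  assumes "\<omega> \<ge> 0" "\<not> is_pole (tf_eval G) (\<i> * of_real \<omega>)"
    and "1 - of_real \<sigma> * tf_eval G (\<i> * of_real \<omega>) \<noteq> 0"
  shows "\<omega> \<in> of_pd_band G \<sigma> \<longleftrightarrow>
    Re (tf_eval G (\<i> * of_real \<omega>)) \<ge> \<sigma> * (cmod (tf_eval G (\<i> * of_real \<omega>)))\<^sup>2"
  using assms Re_feedback_nonneg_iff[OF assms(3)] by (simp add: of_pd_band_def tf_H_def)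

theorem corollary3:
  fixes G :: transfer_function
  assumes "tf_real G" and "tf_strictly_proper G"
  shows "(\<forall>\<sigma> \<omega> :: real. \<sigma> \<ge> 0 \<longrightarrow> \<omega> \<ge> 0 \<longrightarrow>
            \<not> is_pole (tf_eval G) (\<i> * of_real \<omega>) \<longrightarrow>
            1 - of_real \<sigma> * tf_eval G (\<i> * of_real \<omega>) \<noteq> 0 \<longrightarrow>
            (\<omega> \<in> scalar_rayleigh_screened_band G \<sigma> \<longleftrightarrow> \<omega> \<in> of_pd_band G \<sigma>))
       \<and> (\<forall>\<sigma>1 \<sigma>2 :: real. \<sigma>2 > \<sigma>1 \<longrightarrow> (\<forall>\<omega> :: real. \<omega> \<ge> 0 \<longrightarrow>
            \<not> is_pole (tf_eval G) (\<i> * of_real \<omega>) \<longrightarrow>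
            1 - of_real \<sigma>1 * tf_eval G (\<i> * of_real \<omega>) \<noteq> 0 \<longrightarrow>
            1 - of_real \<sigma>2 * tf_eval G (\<i> * of_real \<omega>) \<noteq> 0 \<longrightarrow>
            \<omega> \<in> of_pd_band G \<sigma>2 \<longrightarrow> \<omega> \<in> of_pd_band G \<sigma>1))"
proof (intro conjI allI impI)
  fix \<sigma> \<omega> :: real
  assume "\<omega> \<ge> 0" "\<not> is_pole (tf_eval G) (\<i> * of_real \<omega>)"
    "1 - of_real \<sigma> * tf_eval G (\<i> * of_real \<omega>) \<noteq> 0"
  then show "\<omega> \<in> scalar_rayleigh_screened_band G \<sigma> \<longleftrightarrow> \<omega> \<in> of_pd_band G \<sigma>"
    \<comment> \<open>For a 1 x 1 matrix every Rayleigh quotient is the entry itself, so both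
      memberships become the same inequality in \<open>G\<close>.\<close>
    unfolding scalar_rayleigh_screened_band_eq by (simp add: mem_of_pd_band_iff)
next
  fix \<sigma>1 \<sigma>2 \<omega> :: real
  let ?g = "tf_eval G (\<i> * of_real \<omega>)"
  assume *: "\<omega> \<ge> 0" "\<not> is_pole (tf_eval G) (\<i> * of_real \<omega>)"
    and 1: "1 - of_real \<sigma>1 * ?g \<noteq> 0" and 2: "1 - of_real \<sigma>2 * ?g \<noteq> 0"
    and "\<sigma>2 > \<sigma>1" and mem: "\<omega> \<in> of_pd_band G \<sigma>2"
  \<comment> \<open>Only weak monotonicity is available, since \<open>?g\<close> may vanish; the
    band condition is itself a weak inequality.\<close>
  have "\<sigma>1 * (cmod ?g)\<^sup>2 \<le> \<sigma>2 * (cmod ?g)\<^sup>2"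
    using \<open>\<sigma>2 > \<sigma>1\<close> by (intro mult_right_mono) auto
  also have "\<dots> \<le> Re ?g"
    using mem mem_of_pd_band_iff[OF * 2] by blast
  finally show "\<omega> \<in> of_pd_band G \<sigma>1"
    using mem_of_pd_band_iff[OF * 1] by blast
qed

end
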